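(* Let $Y$ be a Hausdorff topological group, $G$ a dense subgroup of $Y$ (acting on $Y$ by left multiplication), and let $m:\mathcal B(Y)\to[0,\infty]$ be a $\sigma$-finite $\sigma$-smooth measure that is left quasi-invariant relative to $G$ and satisfies $0<m(U)$ for each non-empty open symmetric subset $U=U^{-1}$ of $Y$ with $U\in\mathcal B(Y)$. Then the Souslin number of $Y$ is countable: $s(Y)\le\aleph_0$.
   Context: $\mathcal B(Y)$ is the smallest $\sigma$-algebra on $Y$ containing all zero sets $f^{-1}(0)$, $f\in C_b(Y,\mathbf R)$ (bounded continuous real functions), and their complements. For a $[0,\infty]$-valued measure on $\mathcal B(Y)$, $\sigma$-smooth means countably additive. $m$ is left quasi-invariant relative to $G$ if for each $g\in G$ the measure $m^g(A):=m(g^{-1}A)$ is equivalent to $m$ (same null sets). The Souslin number $s(Y)$ is the supremum of the cardinalities of families of pairwise disjoint non-empty open subsets of $Y$ (and $\aleph_0$ if this is finite). *)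

theory Defs
  imports "HOL-Analysis.Analysis"
begin

unbundle cardinal_syntax

text \<open>
  Hausdorff topological groups are rendered by the type classes \<open>topological_group_add\<close> and
  \<open>t2_space\<close>. The class \<open>group_add\<close> is not assumed commutative, so this is
  an arbitrary group written additively: \<open>g + y\<close> is the product, \<open>- y\<close> the inverse and
  \<open>0\<close> the unit.
\<close>

definition add_subgroup :: "'a::group_add set \<Rightarrow> bool" where
  "add_subgroup G \<longleftrightarrow> 0 \<in> G \<and> (\<forall>g\<in>G. \<forall>h\<in>G. g + h \<in> G) \<and> (\<forall>g\<in>G. - g \<in> G)"

definition zero_sets :: "'a::topological_space set set" where
  "zero_sets = {f -` {0} | f :: 'a \<Rightarrow> real. continuous_on UNIV f \<and> bounded (range f)}"

text \<open>
  The Baire \<open>\<sigma>\<close>-algebra; only \<open>sets baire\<close> is relevant, the measure carried by \<open>baire\<close> is not.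
\<close>

definition baire :: "'a::topological_space measure" where
  "baire = sigma UNIV (zero_sets \<union> uminus ` zero_sets)"

lemma space_baire [simp]: "space baire = UNIV"
  by (simp add: baire_def)

lemma sets_baire: "sets baire = sigma_sets UNIV (zero_sets \<union> uminus ` zero_sets)"
  by (simp add: baire_def)

lemma zero_sets_vimage:
  assumes "continuous_on UNIV h" and "Z \<in> zero_sets"
  shows "h -` Z \<in> zero_sets"
proof -
  obtain f :: "_ \<Rightarrow> real"
    where f: "Z = f -` {0}" "continuous_on UNIV f" "bounded (range f)"
    using assms(2) by (auto simp: zero_sets_def)
  have "h -` Z = (\<lambda>x. f (h x)) -` {0}"
    using f(1) by auto
  moreover have "continuous_on UNIV (\<lambda>x. f (h x))"
    using continuous_on_compose2[OF f(2) assms(1)] by simp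
  moreover have "bounded (range (\<lambda>x. f (h x)))"
    by (rule bounded_subset[OF f(3)]) auto
  ultimately show ?thesis
    unfolding zero_sets_def by blast
qed

lemma measurable_baire:
  fixes h :: "'a::topological_space \<Rightarrow> 'b::topological_space"
  assumes "continuous_on UNIV h"
  shows "h \<in> measurable baire baire"
proof -
  have "h -` A \<in> sets baire" if A: "A \<in> zero_sets \<union> uminus ` zero_sets" for A
  proof -
    have "h -` A \<in> zero_sets \<union> uminus ` zero_sets"
      using A zero_sets_vimage[OF assms] by (auto simp: vimage_Compl)
    then show ?thesis
      unfolding sets_baire by (rule sigma_sets.Basic)
  qed
  then show ?thesis
    by (intro measurable_sigma_sets[OF sets_baire]) auto
qed

text \<open>
  The measure \<open>m\<^sup>g(A) = m(g\<inverse>A)\<close> is the image of \<open>m\<close> under left translation by \<open>g\<close>; see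
  \<open>emeasure_left_translate\<close> below.
\<close>

definition left_translate :: "'a::topological_group_add \<Rightarrow> 'a measure \<Rightarrow> 'a measure" where
  "left_translate g m = distr m m (\<lambda>y. g + y)"

lemma emeasure_left_translate:
  fixes m :: "'a::topological_group_add measure"
  assumes "sets m = sets baire" and "A \<in> sets m"
  shows "emeasure (left_translate g m) A = emeasure m ((\<lambda>y. - g + y) ` A)"
proof -
  have "(\<lambda>y. g + y) \<in> measurable baire (baire :: 'a measure)"
    by (intro measurable_baire continuous_intros)
  then have meas: "(\<lambda>y. g + y) \<in> measurable m m"
    using measurable_cong_sets[OF assms(1) assms(1)] by simp
  have "space m = UNIV"
    using sets_eq_imp_space_eq[OF assms(1)] by simp
  moreover have "(\<lambda>y. g + y) -` A = (\<lambda>y. - g + y) ` A"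
  proof (intro equalityI subsetI)
    fix x assume "x \<in> (\<lambda>y. g + y) -` A"
    then show "x \<in> (\<lambda>y. - g + y) ` A"
      by (intro image_eqI[of _ _ "g + x"]) auto
  qed auto
  ultimately show ?thesis
    unfolding left_translate_def by (simp add: emeasure_distr[OF meas assms(2)])
qed

definition left_quasi_invariant :: "'a::topological_group_add set \<Rightarrow> 'a measure \<Rightarrow> bool" where
  "left_quasi_invariant G m \<longleftrightarrow> (\<forall>g\<in>G. null_sets (left_translate g m) = null_sets m)"

definition cellular_family :: "'a::topological_space set set \<Rightarrow> bool" where
  "cellular_family F \<longleftrightarrow> (\<forall>U\<in>F. open U \<and> U \<noteq> {}) \<and> disjoint F"

definition souslin_bound :: "'a::topological_space itself \<Rightarrow> 'b rel \<Rightarrow> bool" where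
  "souslin_bound (_ :: 'a itself) r \<longleftrightarrow>
     Card_order r \<and> natLeq \<le>o r \<and> (\<forall>F :: 'a set set. cellular_family F \<longrightarrow> |F| \<le>o r)"

text \<open>
  The Souslin number, i.e. the least infinite cardinal that bounds the cardinality of every cellular
  family. The type \<open>'a set + nat\<close> is large enough to carry this cardinal;
  \<open>souslin_number_least\<close> below shows that leastness does not depend on the choice of the type.
\<close>

definition souslin_number :: "'a::topological_space itself \<Rightarrow> ('a set + nat) rel" where
  "souslin_number T =
     (SOME r. souslin_bound T r \<and> (\<forall>r' :: ('a set + nat) rel. souslin_bound T r' \<longrightarrow> r \<le>o r'))"

lemma souslin_bound_UNIV:
  "souslin_bound TYPE('a::topological_space) |UNIV :: ('a set + nat) set|"
  unfolding souslin_bound_def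
proof (intro conjI allI impI)
  show "Card_order |UNIV :: ('a set + nat) set|"
    by (rule card_of_Card_order)
  have "|UNIV :: nat set| \<le>o |UNIV :: ('a set + nat) set|"
    by (rule card_of_ordLeqI[of Inr]) auto
  then show "natLeq \<le>o |UNIV :: ('a set + nat) set|"
    by (rule ordIso_ordLeq_trans[OF ordIso_symmetric[OF card_of_nat]])
  show "|F| \<le>o |UNIV :: ('a set + nat) set|" for F :: "'a set set"
    by (rule card_of_ordLeqI[of Inl]) auto
qed

lemma souslin_number_props:
  "souslin_bound TYPE('a::topological_space) (souslin_number TYPE('a)) \<and>
   (\<forall>r' :: ('a set + nat) rel. souslin_bound TYPE('a) r' \<longrightarrow> souslin_number TYPE('a) \<le>o r')"
proof -
  let ?R = "{r :: ('a set + nat) rel. souslin_bound TYPE('a) r}"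
  have "\<exists>r\<in>?R. \<forall>r'\<in>?R. r \<le>o r'"
    using souslin_bound_UNIV by (intro exists_minim_Card_order) (auto simp: souslin_bound_def)
  then have "\<exists>r :: ('a set + nat) rel. souslin_bound TYPE('a) r \<and>
      (\<forall>r' :: ('a set + nat) rel. souslin_bound TYPE('a) r' \<longrightarrow> r \<le>o r')"
    by blast
  then show ?thesis
    unfolding souslin_number_def by (rule someI_ex)
qed

lemma souslin_bound_souslin_number:
  "souslin_bound TYPE('a::topological_space) (souslin_number TYPE('a))"
  using souslin_number_props by blast

lemma souslin_number_least:
  fixes r :: "'b rel"
  assumes "souslin_bound TYPE('a::topological_space) r"
  shows "souslin_number TYPE('a) \<le>o r"
proof -
  let ?s = "souslin_number TYPE('a)"
  have r: "Card_order r" "natLeq \<le>o r" "\<And>F :: 'a set set. cellular_family F \<Longrightarrow> |F| \<le>o r"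
    using assms by (auto simp: souslin_bound_def)
  have s: "Card_order ?s"
    using souslin_bound_souslin_number by (auto simp: souslin_bound_def)
  then have "?s \<le>o r \<or> r \<le>o ?s"
    using r(1) by (intro ordLeq_total) (auto simp: card_order_on_def)
  then show ?thesis
  proof
    assume "r \<le>o ?s"
    then obtain p where p: "Field p \<le> Field ?s" "(r, p) \<in> ordIso" "p \<le>o ?s"
      unfolding internalize_ordLeq[of r ?s] by (elim exE conjE)
    have "souslin_bound TYPE('a) p"
      unfolding souslin_bound_def
    proof (intro conjI allI impI)
      show "Card_order p"
        by (rule Card_order_ordIso2[OF r(1) p(2)])
      show "natLeq \<le>o p"
        by (rule ordLeq_ordIso_trans[OF r(2) p(2)])
      show "|F| \<le>o p" if "cellular_family F" for F :: "'a set set"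
        by (rule ordLeq_ordIso_trans[OF r(3)[OF that] p(2)])
    qed
    then have "?s \<le>o p"
      using souslin_number_props by blast
    then show ?thesis
      by (rule ordLeq_ordIso_trans[OF _ ordIso_symmetric[OF p(2)]])
  qed
qed

end

theory Submission
  imports Defs "HOL-Library.Countable_Set_Type"
begin

text \<open>
  Let \<open>F\<close> be a family of pairwise disjoint non-empty open sets. Every \<open>U \<in> F\<close> contains a point \<open>g\<close>
  of the dense subgroup, and \<open>-g + U\<close> is a neighbourhood of the unit. A topological group is
  completely regular, so \<open>-g + U\<close> contains a symmetric cozero set \<open>V\<close> around the unit
  (\<open>symmetric_cozero_neighbourhood\<close>). By hypothesis \<open>V\<close> has positive measure, and by quasi-invariance
  so has its translate \<open>g + V \<subseteq> U\<close>. These translates are pairwise disjoint, and a \<open>\<sigma>\<close>-finite measure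
  admits only countably many pairwise disjoint sets of positive measure
  (\<open>countable_disjoint_positive\<close>); hence \<open>F\<close> is countable.

  Complete regularity is obtained as in the Birkhoff--Kakutani theorem. Take neighbourhoods \<open>V n\<close> of
  the unit with \<open>V (n+1) + V (n+1) + V (n+1) \<subseteq> V n\<close>, and let \<open>N x\<close> be the infimum of the weights
  \<open>\<Sum>i 2^(-n i)\<close> over all decompositions \<open>x = \<Sum>i x i\<close> with \<open>x i \<in> V (n i)\<close>. Then \<open>N\<close> is
  subadditive and small near the unit, hence continuous, while \<open>N x < 2^(-n)\<close> forces \<open>x \<in> V n\<close>
  (\<open>sum_list_mem_if_weight_less\<close>).
\<close>

section \<open>Disjoint sets of positive measure\<close>

lemma (in sigma_finite_measure) countable_disjoint_positive:
  assumes disj: "disjoint_family_on B I"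
    and meas: "\<And>i. i \<in> I \<Longrightarrow> B i \<in> sets M"
    and pos: "\<And>i. i \<in> I \<Longrightarrow> 0 < emeasure M (B i)"
  shows "countable I"
proof -
  obtain A :: "nat \<Rightarrow> 'a set" where A: "range A \<subseteq> sets M" "(\<Union>n. A n) = space M"
      "\<And>n. emeasure M (A n) \<noteq> \<infinity>"
    using sigma_finite by blast
  have An: "A n \<in> sets M" for n
    using A(1) by auto
  have fin: "emeasure M (A n \<inter> B i) \<noteq> \<infinity>" if "i \<in> I" for n i
  proof -
    have "emeasure M (A n \<inter> B i) \<le> emeasure M (A n)"
      using An by (intro emeasure_mono) auto
    then show ?thesis
      using A(3)[of n] by (auto simp: top_unique)
  qed
  have count: "countable {i \<in> I. measure M (A n \<inter> B i) \<noteq> 0}" for n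
  proof -
    have "(\<lambda>i. measure M (A n \<inter> B i)) summable_on I"
    proof (rule nonneg_bdd_above_summable_on)
      have "(\<Sum>i\<in>J. measure M (A n \<inter> B i)) \<le> measure M (A n)" if J: "J \<subseteq> I" "finite J" for J
      proof -
        have "(\<Sum>i\<in>J. measure M (A n \<inter> B i)) = measure M (\<Union>i\<in>J. A n \<inter> B i)"
        proof (rule measure_finite_Union[symmetric])
          show "disjoint_family_on (\<lambda>i. A n \<inter> B i) J"
            using disj J(1) unfolding disjoint_family_on_def by blast
        qed (use J meas An fin in auto)
        also have "\<dots> \<le> measure M (A n)"
          using J meas An A(3)[of n] by (intro measure_mono_fmeasurable)
            (auto simp: fmeasurable_def less_top)
        finally show ?thesis .
      qed
      then show "bdd_above (sum (\<lambda>i. measure M (A n \<inter> B i)) ` {J. J \<subseteq> I \<and> finite J})"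
        by (intro bdd_aboveI[where M = "measure M (A n)"]) auto
    qed auto
    then show ?thesis
      by (rule summable_countable_real)
  qed
  have "I \<subseteq> (\<Union>n. {i \<in> I. measure M (A n \<inter> B i) \<noteq> 0})"
  proof
    fix i assume i: "i \<in> I"
    have "\<exists>n. emeasure M (A n \<inter> B i) \<noteq> 0"
    proof (rule ccontr)
      assume "\<nexists>n. emeasure M (A n \<inter> B i) \<noteq> 0"
      then have "(\<Union>n. A n \<inter> B i) \<in> null_sets M"
        using An meas[OF i] by (intro null_sets_UN) (auto simp: null_sets_def)
      moreover have "(\<Union>n. A n \<inter> B i) = B i"
        using A(2) sets.sets_into_space[OF meas[OF i]] by blast
      ultimately show False
        using pos[OF i] by (auto simp: null_sets_def)
    qed
    then obtain n where "emeasure M (A n \<inter> B i) \<noteq> 0" ..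
    then have "measure M (A n \<inter> B i) \<noteq> 0"
      using fin[OF i, of n] by (auto simp: measure_def enn2real_eq_0_iff)
    with i show "i \<in> (\<Union>n. {i \<in> I. measure M (A n \<inter> B i) \<noteq> 0})"
      by blast
  qed
  then show ?thesis
    using count by (auto intro: countable_subset)
qed

section \<open>Complete regularity of topological groups\<close>

lemma open_neighbourhood_add:
  fixes W :: "'a::topological_group_add set"
  assumes "open W" "0 \<in> W"
  obtains V where "open V" "0 \<in> V" "\<And>x y. x \<in> V \<Longrightarrow> y \<in> V \<Longrightarrow> x + y \<in> W"
proof -
  have "((\<lambda>p. fst p + snd p) \<longlongrightarrow> 0 + (0::'a)) (nhds 0 \<times>\<^sub>F nhds 0)"
    by (intro tendsto_add filterlim_fst filterlim_snd)
  then have "eventually (\<lambda>p. fst p + snd p \<in> W) (nhds 0 \<times>\<^sub>F nhds 0)"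
    using assms by (intro topological_tendstoD) auto
  then obtain P Q where PQ: "eventually P (nhds 0)" "eventually Q (nhds 0)"
      "\<And>x y. P x \<Longrightarrow> Q y \<Longrightarrow> x + y \<in> W"
    unfolding eventually_prod_filter by auto
  then have "eventually (\<lambda>x. P x \<and> Q x) (nhds 0)"
    by (simp add: eventually_conj)
  then obtain V where "open V" "0 \<in> V" "\<And>x. x \<in> V \<Longrightarrow> P x \<and> Q x"
    unfolding eventually_nhds by auto
  with PQ(3) show ?thesis
    by (intro that[of V]) auto
qed

lemma open_neighbourhood_add3:
  fixes W :: "'a::topological_group_add set"
  assumes "open W" "0 \<in> W"
  obtains V where "open V" "0 \<in> V"
    "\<And>x y z. x \<in> V \<Longrightarrow> y \<in> V \<Longrightarrow> z \<in> V \<Longrightarrow> x + y + z \<in> W"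
proof -
  obtain U where U: "open U" "0 \<in> U" "\<And>x y. x \<in> U \<Longrightarrow> y \<in> U \<Longrightarrow> x + y \<in> W"
    using open_neighbourhood_add[OF assms] by metis
  obtain V where V: "open V" "0 \<in> V" "\<And>x y. x \<in> V \<Longrightarrow> y \<in> V \<Longrightarrow> x + y \<in> U"
    using open_neighbourhood_add[OF U(1,2)] by metis
  have "V \<subseteq> U"
    using V(2,3) by force
  with U(3) V show ?thesis
    by (intro that[of V]) auto
qed

text \<open>
  The sequence starts with the whole group, so that every element has a decomposition of weight \<open>1\<close>.
\<close>

lemma neighbourhood_sequence:
  fixes W :: "'a::topological_group_add set"
  assumes "open W" "0 \<in> W"
  obtains V :: "nat \<Rightarrow> 'a set" where "\<And>n. open (V n)" "\<And>n. 0 \<in> V n" "V 0 = UNIV" "V 1 \<subseteq> W"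
    "\<And>n x y z. x \<in> V (Suc n) \<Longrightarrow> y \<in> V (Suc n) \<Longrightarrow> z \<in> V (Suc n) \<Longrightarrow> x + y + z \<in> V n"
proof -
  define P where "P n V \<longleftrightarrow> open V \<and> 0 \<in> V \<and> (if n = 0 then V = UNIV else V \<subseteq> W)"
    for n :: nat and V :: "'a set"
  define Q where "Q V V' \<longleftrightarrow> (\<forall>x\<in>V'. \<forall>y\<in>V'. \<forall>z\<in>V'. x + y + z \<in> V)" for V V' :: "'a set"
  have "\<exists>V. \<forall>n. P n (V n) \<and> Q (V n) (V (Suc n))"
  proof (rule dependent_nat_choice)
    show "\<exists>V. P 0 V"
      by (auto simp: P_def)
    show "\<exists>V'. P (Suc n) V' \<and> Q V V'" if "P n V" for n V
    proof -
      have "open (V \<inter> W)" "0 \<in> V \<inter> W"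
        using that assms by (auto simp: P_def)
      then obtain V' where V': "open V'" "0 \<in> V'"
          "\<And>x y z. x \<in> V' \<Longrightarrow> y \<in> V' \<Longrightarrow> z \<in> V' \<Longrightarrow> x + y + z \<in> V \<inter> W"
        using open_neighbourhood_add3 by metis
      have "V' \<subseteq> W"
        using V'(2) V'(3)[of _ 0 0] by auto
      with V' show ?thesis
        unfolding P_def Q_def by (intro exI[of _ V']) auto
    qed
  qed
  then obtain V where V: "\<And>n. P n (V n)" "\<And>n. Q (V n) (V (Suc n))"
    by blast
  show ?thesis
  proof (rule that[of V])
    show "V 0 = UNIV" "V 1 \<subseteq> W"
      using V(1)[of 0] V(1)[of 1] by (auto simp: P_def)
    show "open (V n)" "0 \<in> V n" for n
      using V(1)[of n] by (auto simp: P_def)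
    show "x + y + z \<in> V n" if "x \<in> V (Suc n)" "y \<in> V (Suc n)" "z \<in> V (Suc n)" for n x y z
      using V(2)[of n] that by (auto simp: Q_def)
  qed
qed

lemma nonneg_list_split:
  fixes f :: "'b \<Rightarrow> real"
  assumes "\<And>x. f x \<ge> 0" and "c \<ge> 0" and "c < sum_list (map f xs)"
  obtains ys x zs where "xs = ys @ x # zs"
    "sum_list (map f ys) \<le> c" "c < sum_list (map f ys) + f x"
  using assms(2,3)
proof (induction xs arbitrary: thesis c)
  case (Cons a xs)
  show ?case
  proof (cases "c < f a")
    case True
    then show ?thesis
      using Cons.prems by (intro Cons.prems(1)[of "[]" a xs]) auto
  next
    case False
    then have "0 \<le> c - f a" "c - f a < sum_list (map f xs)"
      using Cons.prems by auto
    then obtain ys x zs where "xs = ys @ x # zs"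
        "sum_list (map f ys) \<le> c - f a" "c - f a < sum_list (map f ys) + f x"
      using Cons.IH by metis
    then show ?thesis
      by (intro Cons.prems(1)[of "a # ys" x zs]) auto
  qed
qed auto

text \<open>
  A decomposition is a list of pairs \<open>(k, x)\<close> with \<open>x \<in> V k\<close>. It is split around the entry at which
  the partial sums of the weights pass half of the total weight; both remaining parts then have
  weight below \<open>2^(-n-1)\<close>.
\<close>

lemma sum_list_mem_if_weight_less:
  fixes V :: "nat \<Rightarrow> 'a::monoid_add set"
  assumes zero: "\<And>n. 0 \<in> V n"
    and add3: "\<And>n x y z. x \<in> V (Suc n) \<Longrightarrow> y \<in> V (Suc n) \<Longrightarrow> z \<in> V (Suc n) \<Longrightarrow> x + y + z \<in> V n"
    and mem: "\<forall>p\<in>set xs. snd p \<in> V (fst p)"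
    and weight: "(\<Sum>p\<leftarrow>xs. (1/2::real) ^ fst p) < (1/2) ^ n"
  shows "sum_list (map snd xs) \<in> V n"
  using mem weight
proof (induction "length xs" arbitrary: xs n rule: less_induct)
  case less
  let ?w = "\<lambda>xs :: (nat \<times> 'a) list. \<Sum>p\<leftarrow>xs. (1/2::real) ^ fst p"
  have antimono: "V k \<subseteq> V l" if "l \<le> k" for k l
    using that
  proof (induction k rule: dec_induct)
    case (step k)
    have "V (Suc k) \<subseteq> V k"
      using zero[of "Suc k"] add3[of _ k 0 0] by auto
    with step show ?case by blast
  qed simp
  have w_nonneg: "?w xs \<ge> 0" for xs
    by (intro sum_list_nonneg) auto
  show ?case
  proof (cases "xs = []")
    case True
    then show ?thesis
      using zero by simp
  next
    case False
    then obtain a as where as: "xs = a # as"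
      by (cases xs) auto
    have "?w xs > 0"
      using w_nonneg[of as] unfolding as by (simp add: add_pos_nonneg)
    then have "?w xs / 2 \<ge> 0" "?w xs / 2 < ?w xs"
      by simp_all
    then obtain ys p zs where split: "xs = ys @ p # zs"
        and half: "?w ys \<le> ?w xs / 2" "?w xs / 2 < ?w ys + (1/2) ^ fst p"
      by - (rule nonneg_list_split[of "\<lambda>p. (1/2) ^ fst p" "?w xs / 2" xs], simp_all)
    have total: "?w xs = ?w ys + (1/2) ^ fst p + ?w zs"
      unfolding split by simp
    have "?w ys < (1/2) ^ Suc n" "?w zs < (1/2) ^ Suc n"
      using half total less.prems(2) by simp_all
    then have "sum_list (map snd ys) \<in> V (Suc n)" "sum_list (map snd zs) \<in> V (Suc n)"
      using less.prems(1) by (intro less.hyps; simp add: split)+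
    moreover have "snd p \<in> V (Suc n)"
    proof -
      have "(1/2::real) ^ fst p < (1/2) ^ n"
        using total less.prems(2) w_nonneg[of ys] w_nonneg[of zs] by linarith
      then have "Suc n \<le> fst p"
        by (simp add: power_strict_decreasing_iff Suc_le_eq)
      then show ?thesis
        using antimono less.prems(1) split by fastforce
    qed
    ultimately have "sum_list (map snd ys) + snd p + sum_list (map snd zs) \<in> V n"
      by (intro add3)
    then show ?thesis
      unfolding split by (simp add: add.assoc)
  qed
qed

lemma completely_regular_at_unit:
  fixes W :: "'a::topological_group_add set"
  assumes "open W" "0 \<in> W"
  obtains f :: "'a \<Rightarrow> real" where "continuous_on UNIV f" "bounded (range f)"
    "f 0 \<noteq> 0" "\<And>x. f x \<noteq> 0 \<Longrightarrow> x \<in> W"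
proof -
  obtain V :: "nat \<Rightarrow> 'a set" where V: "\<And>n. open (V n)" "\<And>n. 0 \<in> V n" "V 0 = UNIV" "V 1 \<subseteq> W"
    "\<And>n x y z. x \<in> V (Suc n) \<Longrightarrow> y \<in> V (Suc n) \<Longrightarrow> z \<in> V (Suc n) \<Longrightarrow> x + y + z \<in> V n"
    using neighbourhood_sequence[OF assms] by metis
  define w where "w xs = (\<Sum>p\<leftarrow>xs. (1/2::real) ^ fst p)" for xs :: "(nat \<times> 'a) list"
  define D where "D x = {xs. (\<forall>p\<in>set xs. snd p \<in> V (fst p)) \<and> sum_list (map snd xs) = x}" for x
  define N where "N x = (INF xs\<in>D x. w xs)" for x
  have w_nonneg: "w xs \<ge> 0" for xs
    unfolding w_def by (intro sum_list_nonneg) auto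
  have bdd: "bdd_below (w ` D x)" for x
    using w_nonneg by (intro bdd_belowI[where m = 0]) auto
  have N_le: "N x \<le> w xs" if "xs \<in> D x" for x xs
    unfolding N_def using bdd that by (rule cINF_lower)
  have N_le_power: "N x \<le> (1/2) ^ n" if "x \<in> V n" for x n
    using N_le[of "[(n, x)]" x] that by (simp add: D_def w_def)
  have nonempty: "D x \<noteq> {}" for x
  proof -
    have "[(0, x)] \<in> D x"
      using V(3) by (simp add: D_def)
    then show ?thesis by blast
  qed
  have N_nonneg: "N x \<ge> 0" for x
    unfolding N_def using nonempty w_nonneg by (intro cINF_greatest)
  have N_add: "N (x + y) \<le> N x + N y" for x y
  proof -
    have "N (x + y) - w ys \<le> w xs" if "xs \<in> D x" "ys \<in> D y" for xs ys
    proof -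
      have "xs @ ys \<in> D (x + y)" "w (xs @ ys) = w xs + w ys"
        using that by (auto simp: D_def w_def)
      then show ?thesis
        using N_le[of "xs @ ys" "x + y"] by simp
    qed
    then have "N (x + y) - w ys \<le> N x" if "ys \<in> D y" for ys
      unfolding N_def[of x] using nonempty that by (intro cINF_greatest)
    then have "N (x + y) - N x \<le> w ys" if "ys \<in> D y" for ys
      using that by (simp add: algebra_simps)
    then have "N (x + y) - N x \<le> N y"
      unfolding N_def[of y] using nonempty by (intro cINF_greatest)
    then show ?thesis by simp
  qed
  have N_zero: "N 0 \<le> 0"
    using N_le[of "[]" 0] by (simp add: D_def w_def)
  have mem_W: "x \<in> W" if less: "N x < 1/2" for x
  proof -
    obtain xs where xs: "xs \<in> D x" "w xs < 1/2"
      using iffD1[OF cINF_less_iff[OF nonempty bdd] less[unfolded N_def]] by auto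
    then have "x \<in> V 1"
      using sum_list_mem_if_weight_less[of V xs 1] V(2,5) by (auto simp: D_def w_def)
    with V(4) show ?thesis by blast
  qed
  have cont: "continuous_on UNIV N"
  proof -
    have "(N \<longlongrightarrow> N x) (nhds x)" for x
    proof (rule tendstoI)
      fix e :: real assume "e > 0"
      then obtain n where n: "(1/2) ^ n < e"
        using real_arch_pow_inv[of e "1/2"] by auto
      have "open ((\<lambda>z. - x + z) -` V n \<inter> (\<lambda>z. - z + x) -` V n)"
        using V(1) by (intro open_Int open_vimage continuous_intros)
      moreover have "x \<in> (\<lambda>z. - x + z) -` V n \<inter> (\<lambda>z. - z + x) -` V n"
        using V(2) by simp
      moreover have "dist (N z) (N x) < e"
        if "z \<in> (\<lambda>z. - x + z) -` V n \<inter> (\<lambda>z. - z + x) -` V n" for z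
      proof -
        have "N (- x + z) \<le> (1/2) ^ n" "N (- z + x) \<le> (1/2) ^ n"
          using that by (auto intro: N_le_power)
        moreover have "N z \<le> N x + N (- x + z)" "N x \<le> N z + N (- z + x)"
          using N_add[of x "- x + z"] N_add[of z "- z + x"] by (simp_all add: add.assoc[symmetric])
        ultimately show ?thesis
          using n by (simp add: dist_real_def abs_if)
      qed
      ultimately show "eventually (\<lambda>z. dist (N z) (N x) < e) (nhds x)"
        unfolding eventually_nhds by blast
    qed
    then show ?thesis
      by (simp add: continuous_on_def tendsto_nhds_iff)
  qed
  \<comment> \<open>The level \<open>1/2\<close> is the threshold below which \<open>N\<close> forces membership in \<open>V 1 \<subseteq> W\<close>.\<close>
  show ?thesis
  proof (rule that[of "\<lambda>x. max 0 (1/2 - N x)"])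
    show "continuous_on UNIV (\<lambda>x. max 0 (1/2 - N x))"
      by (intro continuous_intros cont)
    show "bounded (range (\<lambda>x. max 0 (1/2 - N x)))"
    proof (intro boundedI[where B = "1/2"])
      fix r assume "r \<in> range (\<lambda>x. max 0 (1/2 - N x))"
      then obtain x where "r = max 0 (1/2 - N x)" ..
      then show "norm r \<le> 1/2"
        using N_nonneg[of x] by (simp add: max_def)
    qed
    show "max 0 (1/2 - N 0) \<noteq> 0"
      using N_zero by simp
    show "x \<in> W" if "max 0 (1/2 - N x) \<noteq> 0" for x
      using that by (intro mem_W) (auto simp: max_def split: if_splits)
  qed
qed

text \<open>
  The symmetric set is the cozero set of \<open>x \<mapsto> f x * f (- x)\<close>, written as an intersection.
\<close>

lemma symmetric_cozero_neighbourhood: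
  fixes W :: "'a::topological_group_add set"
  assumes "open W" "0 \<in> W"
  obtains V where "open V" "0 \<in> V" "V \<subseteq> W" "V = uminus ` V" "V \<in> sets baire"
proof -
  obtain f :: "'a \<Rightarrow> real" where f: "continuous_on UNIV f" "bounded (range f)"
      "f 0 \<noteq> 0" "\<And>x. f x \<noteq> 0 \<Longrightarrow> x \<in> W"
    using completely_regular_at_unit[OF assms] by metis
  define U where "U = - (f -` {0})"
  have U: "open U"
    unfolding U_def using f(1) by (intro open_Compl closed_vimage) auto
  have U_baire: "U \<in> sets baire"
    using f(1,2) unfolding U_def sets_baire zero_sets_def by (intro sigma_sets.Basic) blast
  have cont: "continuous_on UNIV (uminus :: 'a \<Rightarrow> 'a)"
    by (intro continuous_intros)
  show ?thesis
  proof (rule that[of "U \<inter> uminus -` U"])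
    show "open (U \<inter> uminus -` U)"
      using U cont by (intro open_Int open_vimage)
    show "0 \<in> U \<inter> uminus -` U" "U \<inter> uminus -` U \<subseteq> W"
      using f(3,4) by (auto simp: U_def)
    show "U \<inter> uminus -` U = uminus ` (U \<inter> uminus -` U)"
    proof (intro equalityI subsetI)
      fix x assume "x \<in> U \<inter> uminus -` U"
      then show "x \<in> uminus ` (U \<inter> uminus -` U)"
        by (intro image_eqI[of _ _ "- x"]) auto
    qed auto
    have "uminus -` U \<in> sets baire"
      using measurable_sets[OF measurable_baire[OF cont] U_baire] by simp
    then show "U \<inter> uminus -` U \<in> sets baire"
      using U_baire by blast
  qed
qed

section \<open>Countability of cellular families\<close>

lemma emeasure_translate_pos:
  fixes m :: "'a::topological_group_add measure"
  assumes sets: "sets m = sets baire" and "left_quasi_invariant G m" and "g \<in> G"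
    and V: "V \<in> sets m" "0 < emeasure m V"
  shows "(\<lambda>y. g + y) ` V \<in> sets m" "0 < emeasure m ((\<lambda>y. g + y) ` V)"
proof -
  have "(\<lambda>y. - g + y) \<in> measurable baire (baire :: 'a measure)"
    by (intro measurable_baire continuous_intros)
  from measurable_sets[OF this, of V] have "(\<lambda>y. - g + y) -` V \<in> sets m"
    using V(1) sets by simp
  also have "(\<lambda>y. - g + y) -` V = (\<lambda>y. g + y) ` V"
  proof (intro equalityI subsetI)
    fix x assume "x \<in> (\<lambda>y. - g + y) -` V"
    then show "x \<in> (\<lambda>y. g + y) ` V"
      by (intro image_eqI[of _ _ "- g + x"]) (auto simp: add.assoc[symmetric])
  qed (auto simp: add.assoc[symmetric])
  finally show gV: "(\<lambda>y. g + y) ` V \<in> sets m" .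
  have "emeasure (left_translate g m) ((\<lambda>y. g + y) ` V) = emeasure m V"
    using emeasure_left_translate[OF sets gV, of g]
    by (simp add: image_image add.assoc[symmetric])
  then have "(\<lambda>y. g + y) ` V \<notin> null_sets (left_translate g m)"
    using V(2) by (auto simp: null_sets_def)
  then have "(\<lambda>y. g + y) ` V \<notin> null_sets m"
    using assms(2,3) by (auto simp: left_quasi_invariant_def)
  then show "0 < emeasure m ((\<lambda>y. g + y) ` V)"
    using gV by (auto simp: null_sets_def zero_less_iff_neq_zero)
qed

theorem proposition5:
  fixes G :: "'a::{topological_group_add, t2_space} set"
    and m :: "'a measure"
  assumes "add_subgroup G"
    and "closure G = UNIV"
    and "sets m = sets baire"
    and "sigma_finite_measure m"
    and "left_quasi_invariant G m"
    and "\<And>U. open U \<Longrightarrow> U \<noteq> {} \<Longrightarrow> U = uminus ` U \<Longrightarrow> U \<in> sets baire \<Longrightarrow> 0 < emeasure m U"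
  shows "souslin_number TYPE('a) \<le>o natLeq"
proof (rule souslin_number_least)
  have "countable F" if F: "cellular_family F" for F :: "'a set set"
  proof -
    have "\<exists>B\<subseteq>U. B \<in> sets m \<and> 0 < emeasure m B" if "U \<in> F" for U
    proof -
      have U: "open U" "U \<noteq> {}"
        using F that by (auto simp: cellular_family_def)
      then obtain g where g: "g \<in> G" "g \<in> U"
        using assms(2) open_Int_closure_eq_empty[of U G] by auto
      have "open ((\<lambda>y. g + y) -` U)" "0 \<in> (\<lambda>y. g + y) -` U"
        using U g by (auto intro!: open_vimage continuous_intros)
      then obtain V where V: "open V" "0 \<in> V" "V \<subseteq> (\<lambda>y. g + y) -` U" "V = uminus ` V"
          "V \<in> sets baire"
        by (rule symmetric_cozero_neighbourhood)
      have "0 < emeasure m V"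
        using V by (intro assms(6)) auto
      then have "(\<lambda>y. g + y) ` V \<in> sets m" "0 < emeasure m ((\<lambda>y. g + y) ` V)"
        using emeasure_translate_pos[OF assms(3,5) g(1)] V(5) assms(3) by auto
      with V(3) show ?thesis
        by (intro exI[of _ "(\<lambda>y. g + y) ` V"]) auto
    qed
    then obtain B where B: "\<And>U. U \<in> F \<Longrightarrow> B U \<subseteq> U"
        "\<And>U. U \<in> F \<Longrightarrow> B U \<in> sets m" "\<And>U. U \<in> F \<Longrightarrow> 0 < emeasure m (B U)"
      by metis
    have "disjoint F"
      using F by (simp add: cellular_family_def)
    then have "disjoint_family_on B F"
      unfolding disjoint_family_on_def disjoint_def using B(1) by blast
    then show ?thesis
      by (rule sigma_finite_measure.countable_disjoint_positive[OF assms(4) _ B(2,3)])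
  qed
  then have "|F| \<le>o natLeq" if "cellular_family F" for F :: "'a set set"
    using that by (simp only: countable_card_le_natLeq[symmetric])
  then show "souslin_bound TYPE('a) natLeq"
    unfolding souslin_bound_def
    using natLeq_Card_order natLeq_Well_order ordLeq_reflexive by blast
qed

end
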